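(* Let $(a_n)_{n\in\mathbb{N}}$ be any sequence of natural numbers. There exist a metric space $X$ with a basepoint $e\in X$ and a sequence $(\alpha_n)_{n\in\mathbb{N}}$ of scaling factors such that for every non-principal ultrafilter $\mu$ on $\mathbb{N}$ and all $i,j\in\mathbb{N}$, the iterated cones $\operatorname{Cone}^i_\mu(X,e,(\alpha_n))$ and $\operatorname{Cone}^j_\mu(X,e,(\alpha_n))$ are homeomorphic if and only if $a_i=a_j$.
   Context: A scaling factor is a sequence $\alpha=(\alpha^{(k)})_{k\in\mathbb{N}}$ of positive real numbers diverging to $+\infty$; here each $\alpha_n$ is itself a scaling factor. For an ultrafilter $\mu$ on $\mathbb{N}$ and a sequence $(x_k)$ in $[0,+\infty]$, $\mu\text{-}\lim x_k$ is the unique $a\in[0,+\infty]$ such that for every neighborhood $U$ of $a$ one has $\{k: x_k\in U\}\in\mu$. Asymptotic cone: for a metric space $(X,d)$, a non-principal ultrafilter $\mu$ on $\mathbb{N}$, a point $e\in X$ and a scaling factor $\alpha=(\alpha^{(k)})$, $\operatorname{Cone}_\mu(X,e,\alpha)$ is the quotient of $\{(x_k)\in X^{\mathbb{N}}: \mu\text{-}\lim d(x_k,e)/\alpha^{(k)}<+\infty\}$ by the relation $(x_k)\approx(y_k)\iff \mu\text{-}\lim d(x_k,y_k)/\alpha^{(k)}=0$, with metric $d_\infty([x_k],[y_k])=\mu\text{-}\lim d(x_k,y_k)/\alpha^{(k)}$. Iterated cones with varying scaling factors: for a sequence of scaling factors $(\alpha_n)_{n\in\mathbb{N}}$ set $\operatorname{Cone}^0_\mu(X,e,(\alpha_n))=X$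 with basepoint $e$, and for $i\in\mathbb{N}$ set $\operatorname{Cone}^{i+1}_\mu(X,e,(\alpha_n))=\operatorname{Cone}_\mu(\operatorname{Cone}^i_\mu(X,e,(\alpha_n)),\hat e,\alpha_{i+1})$, where $\hat e$ denotes the basepoint of the $i$-th iterated cone; the basepoint of the $(i+1)$-st iterated cone is the class of the constant sequence with value the basepoint of the $i$-th. Natural numbers include $0$. *)

theory Defs
  imports "HOL-Analysis.Analysis"
begin

text \<open>
  An ultrafilter on \<open>\<nat>\<close>, given as a set \<open>U\<close> of subsets, is represented by the library filter
  \<open>\<mu>\<close> with \<open>A \<in> U \<longleftrightarrow> eventually (\<lambda>k. k \<in> A) \<mu>\<close>.
\<close>

definition ultrafilter :: "nat filter \<Rightarrow> bool" where
  "ultrafilter \<mu> \<longleftrightarrow> \<mu> \<noteq> bot \<and> (\<forall>P. eventually P \<mu> \<or> eventually (\<lambda>k. \<not> P k) \<mu>)"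

definition nonprincipal_ultrafilter :: "nat filter \<Rightarrow> bool" where
  "nonprincipal_ultrafilter \<mu> \<longleftrightarrow> ultrafilter \<mu> \<and> (\<forall>n. \<not> eventually (\<lambda>k. k = n) \<mu>)"

definition scaling_factor :: "(nat \<Rightarrow> real) \<Rightarrow> bool" where
  "scaling_factor \<alpha> \<longleftrightarrow> (\<forall>k. \<alpha> k > 0) \<and> filterlim \<alpha> at_top sequentially"


section \<open>Asymptotic cones\<close>

text \<open>
  The limit is taken in \<open>[0, \<infinity>]\<close> (type \<^typ>\<open>ennreal\<close>); \<^term>\<open>Lim \<mu> x\<close> is the unique \<open>a\<close> such that
  every neighbourhood of \<open>a\<close> contains \<open>x k\<close> for \<open>\<mu>\<close>-almost all \<open>k\<close>.
\<close>

definition ulim_dist ::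
    "nat filter \<Rightarrow> 'a metric \<Rightarrow> (nat \<Rightarrow> real) \<Rightarrow> (nat \<Rightarrow> 'a) \<Rightarrow> (nat \<Rightarrow> 'a) \<Rightarrow> ennreal" where
  "ulim_dist \<mu> X \<alpha> x y = Lim \<mu> (\<lambda>k. ennreal (mdist X (x k) (y k) / \<alpha> k))"

definition cone_seqs ::
    "nat filter \<Rightarrow> 'a metric \<Rightarrow> 'a \<Rightarrow> (nat \<Rightarrow> real) \<Rightarrow> (nat \<Rightarrow> 'a) set" where
  "cone_seqs \<mu> X e \<alpha> = {x. (\<forall>k. x k \<in> mspace X) \<and> ulim_dist \<mu> X \<alpha> x (\<lambda>_. e) < \<infinity>}"

definition cone_rel ::
    "nat filter \<Rightarrow> 'a metric \<Rightarrow> 'a \<Rightarrow> (nat \<Rightarrow> real) \<Rightarrow> ((nat \<Rightarrow> 'a) \<times> (nat \<Rightarrow> 'a)) set" where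
  "cone_rel \<mu> X e \<alpha> =
     {(x, y). x \<in> cone_seqs \<mu> X e \<alpha> \<and> y \<in> cone_seqs \<mu> X e \<alpha> \<and> ulim_dist \<mu> X \<alpha> x y = 0}"

definition cone_points ::
    "nat filter \<Rightarrow> 'a metric \<Rightarrow> 'a \<Rightarrow> (nat \<Rightarrow> real) \<Rightarrow> (nat \<Rightarrow> 'a) set set" where
  "cone_points \<mu> X e \<alpha> = cone_seqs \<mu> X e \<alpha> // cone_rel \<mu> X e \<alpha>"

text \<open>
  The distance is evaluated on chosen representatives; \<open>mdist_cone\<close> below shows that it does not
  depend on them.
\<close>

definition cone_dist ::
    "nat filter \<Rightarrow> 'a metric \<Rightarrow> (nat \<Rightarrow> real) \<Rightarrow> (nat \<Rightarrow> 'a) set \<Rightarrow> (nat \<Rightarrow> 'a) set \<Rightarrow> real" where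
  "cone_dist \<mu> X \<alpha> C D = enn2real (ulim_dist \<mu> X \<alpha> (SOME x. x \<in> C) (SOME y. y \<in> D))"

definition cone ::
    "nat filter \<Rightarrow> 'a metric \<Rightarrow> 'a \<Rightarrow> (nat \<Rightarrow> real) \<Rightarrow> (nat \<Rightarrow> 'a) set metric" where
  "cone \<mu> X e \<alpha> = metric (cone_points \<mu> X e \<alpha>, cone_dist \<mu> X \<alpha>)"

definition cone_base ::
    "nat filter \<Rightarrow> 'a metric \<Rightarrow> 'a \<Rightarrow> (nat \<Rightarrow> real) \<Rightarrow> (nat \<Rightarrow> 'a) set" where
  "cone_base \<mu> X e \<alpha> = cone_rel \<mu> X e \<alpha> `` {\<lambda>_. e}"


section \<open>Iterated cones\<close>

text \<open>
  A cone of a metric space on \<^typ>\<open>'a\<close> is a metric space on \<^typ>\<open>(nat \<Rightarrow> 'a) set\<close>, so iterating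
  changes the type at each step. To have all iterated cones on one type, each cone is replaced by an
  isometric copy, in which a class is named by one of its representatives.
  The lemma \<open>iter_cone_Suc_isometric\<close> below shows that nothing else changes.
\<close>

datatype 'a tower = Point 'a | Seq "nat \<Rightarrow> 'a tower"

definition class_name :: "(nat \<Rightarrow> 'a tower) set \<Rightarrow> 'a tower" where
  "class_name C = Seq (SOME x. x \<in> C)"

text \<open>The copy of \<open>X\<close> along a map \<open>f\<close> that is injective on the points of \<open>X\<close>.\<close>

definition metric_copy :: "('a \<Rightarrow> 'b) \<Rightarrow> 'a metric \<Rightarrow> 'b metric" where
  "metric_copy f X = metric (f ` mspace X,
     \<lambda>p q. mdist X (inv_into (mspace X) f p) (inv_into (mspace X) f q))"

text \<open>
  The pair of the \<open>i\<close>-th iterated cone and its basepoint; \<open>\<alpha> n\<close> is the \<open>n\<close>-th scaling factor, and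
  \<open>\<alpha> 0\<close> is not used.
\<close>

primrec pointed_iter_cone ::
    "nat filter \<Rightarrow> 'a metric \<Rightarrow> 'a \<Rightarrow> (nat \<Rightarrow> nat \<Rightarrow> real) \<Rightarrow> nat \<Rightarrow> 'a tower metric \<times> 'a tower" where
  "pointed_iter_cone \<mu> X e \<alpha> 0 = (metric_copy Point X, Point e)"
| "pointed_iter_cone \<mu> X e \<alpha> (Suc i) =
     (let (Y, p) = pointed_iter_cone \<mu> X e \<alpha> i
      in (metric_copy class_name (cone \<mu> Y p (\<alpha> (Suc i))),
          class_name (cone_base \<mu> Y p (\<alpha> (Suc i)))))"

definition iter_cone ::
    "nat filter \<Rightarrow> 'a metric \<Rightarrow> 'a \<Rightarrow> (nat \<Rightarrow> nat \<Rightarrow> real) \<Rightarrow> nat \<Rightarrow> 'a tower metric" where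
  "iter_cone \<mu> X e \<alpha> i = fst (pointed_iter_cone \<mu> X e \<alpha> i)"

definition iter_base ::
    "nat filter \<Rightarrow> 'a metric \<Rightarrow> 'a \<Rightarrow> (nat \<Rightarrow> nat \<Rightarrow> real) \<Rightarrow> nat \<Rightarrow> 'a tower" where
  "iter_base \<mu> X e \<alpha> i = snd (pointed_iter_cone \<mu> X e \<alpha> i)"


section \<open>Well-definedness\<close>

lemma ultrafilter_tendsto_Lim:
  fixes x :: "nat \<Rightarrow> ennreal"
  assumes "ultrafilter \<mu>"
  shows "(x \<longlongrightarrow> Lim \<mu> x) \<mu>"
proof -
  have nb: "\<mu> \<noteq> bot" using assms by (simp add: ultrafilter_def)
  hence "filtermap x \<mu> \<noteq> bot" by (simp add: filtermap_bot_iff)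
  then obtain l where l: "inf (nhds l) (filtermap x \<mu>) \<noteq> bot"
    using compact_UNIV[where 'a = ennreal] unfolding compact_filter by auto
  have "(x \<longlongrightarrow> l) \<mu>"
  proof (rule topological_tendstoI)
    fix S assume S: "open S" "l \<in> S"
    show "eventually (\<lambda>k. x k \<in> S) \<mu>"
    proof (rule ccontr)
      assume "\<not> eventually (\<lambda>k. x k \<in> S) \<mu>"
      hence "eventually (\<lambda>k. x k \<notin> S) \<mu>"
        using assms unfolding ultrafilter_def by blast
      hence 1: "eventually (\<lambda>y. y \<notin> S) (filtermap x \<mu>)" by (simp add: eventually_filtermap)
      have 2: "eventually (\<lambda>y. y \<in> S) (nhds l)" using S by (simp add: eventually_nhds_in_open)
      have "eventually (\<lambda>y. False) (inf (nhds l) (filtermap x \<mu>))"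
        using 1 2 unfolding eventually_inf by blast
      thus False using l by (simp add: trivial_limit_def)
    qed
  qed
  thus ?thesis using tendsto_Lim[OF nb] by metis
qed

lemma ulim_dist_commute: "ulim_dist \<mu> X \<alpha> x y = ulim_dist \<mu> X \<alpha> y x"
  by (simp add: ulim_dist_def mdist_commute)

lemma ulim_dist_refl:
  assumes "ultrafilter \<mu>" "\<forall>k. x k \<in> mspace X"
  shows "ulim_dist \<mu> X \<alpha> x x = 0"
proof -
  have "mdist X (x k) (x k) = 0" for k using assms(2) by simp
  hence "(\<lambda>k. ennreal (mdist X (x k) (x k) / \<alpha> k)) = (\<lambda>_. 0)" by simp
  thus ?thesis using assms(1) unfolding ulim_dist_def ultrafilter_def
    by (metis tendsto_Lim tendsto_const)
qed

lemma ulim_dist_triangle: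
  assumes u: "ultrafilter \<mu>" and a: "\<forall>k. \<alpha> k > 0"
    and m: "\<forall>k. x k \<in> mspace X" "\<forall>k. y k \<in> mspace X" "\<forall>k. z k \<in> mspace X"
  shows "ulim_dist \<mu> X \<alpha> x z \<le> ulim_dist \<mu> X \<alpha> x y + ulim_dist \<mu> X \<alpha> y z"
proof (rule tendsto_le)
  show "\<mu> \<noteq> bot" using u by (simp add: ultrafilter_def)
  show "((\<lambda>k. ennreal (mdist X (x k) (z k) / \<alpha> k)) \<longlongrightarrow> ulim_dist \<mu> X \<alpha> x z) \<mu>"
    unfolding ulim_dist_def by (rule ultrafilter_tendsto_Lim[OF u])
  show "((\<lambda>k. ennreal (mdist X (x k) (y k) / \<alpha> k) + ennreal (mdist X (y k) (z k) / \<alpha> k))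
          \<longlongrightarrow> ulim_dist \<mu> X \<alpha> x y + ulim_dist \<mu> X \<alpha> y z) \<mu>"
    unfolding ulim_dist_def by (intro tendsto_add ultrafilter_tendsto_Lim[OF u])
  have "ennreal (mdist X (x k) (z k) / \<alpha> k)
      \<le> ennreal (mdist X (x k) (y k) / \<alpha> k) + ennreal (mdist X (y k) (z k) / \<alpha> k)" for k
  proof -
    have "mdist X (x k) (z k) / \<alpha> k \<le> (mdist X (x k) (y k) + mdist X (y k) (z k)) / \<alpha> k"
      using m a by (intro divide_right_mono mdist_triangle) (auto intro: less_imp_le)
    moreover have "0 \<le> mdist X (x k) (y k) / \<alpha> k" "0 \<le> mdist X (y k) (z k) / \<alpha> k"
      using a by (simp_all add: less_imp_le)
    ultimately show ?thesis
      by (simp add: add_divide_distrib ennreal_leI flip: ennreal_plus)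
  qed
  thus "\<forall>\<^sub>F k in \<mu>. ennreal (mdist X (x k) (z k) / \<alpha> k)
      \<le> ennreal (mdist X (x k) (y k) / \<alpha> k) + ennreal (mdist X (y k) (z k) / \<alpha> k)" by simp
qed

lemma ulim_dist_finite:
  assumes "ultrafilter \<mu>" "\<forall>k. \<alpha> k > 0" "e \<in> mspace X"
    and "x \<in> cone_seqs \<mu> X e \<alpha>" "y \<in> cone_seqs \<mu> X e \<alpha>"
  shows "ulim_dist \<mu> X \<alpha> x y < \<infinity>"
proof -
  have "ulim_dist \<mu> X \<alpha> x y \<le> ulim_dist \<mu> X \<alpha> x (\<lambda>_. e) + ulim_dist \<mu> X \<alpha> (\<lambda>_. e) y"
    using assms by (intro ulim_dist_triangle) (auto simp: cone_seqs_def)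
  also have "\<dots> < \<infinity>"
    using assms by (auto simp: cone_seqs_def ulim_dist_commute[of \<mu> X \<alpha> "\<lambda>_. e" y])
  finally show ?thesis .
qed

lemma equiv_cone_rel:
  assumes "ultrafilter \<mu>" "\<forall>k. \<alpha> k > 0"
  shows "equiv (cone_seqs \<mu> X e \<alpha>) (cone_rel \<mu> X e \<alpha>)"
proof (rule equivI)
  show "cone_rel \<mu> X e \<alpha> \<subseteq> cone_seqs \<mu> X e \<alpha> \<times> cone_seqs \<mu> X e \<alpha>"
    by (auto simp: cone_rel_def)
  show "refl_on (cone_seqs \<mu> X e \<alpha>) (cone_rel \<mu> X e \<alpha>)"
    using ulim_dist_refl[OF assms(1)] by (auto simp: refl_on_def cone_rel_def cone_seqs_def)
  show "sym (cone_rel \<mu> X e \<alpha>)"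
    by (auto simp: sym_def cone_rel_def ulim_dist_commute)
  show "trans (cone_rel \<mu> X e \<alpha>)"
  proof (rule transI)
    fix x y z assume xy: "(x, y) \<in> cone_rel \<mu> X e \<alpha>" and yz: "(y, z) \<in> cone_rel \<mu> X e \<alpha>"
    have "ulim_dist \<mu> X \<alpha> x z \<le> ulim_dist \<mu> X \<alpha> x y + ulim_dist \<mu> X \<alpha> y z"
      using xy yz assms by (intro ulim_dist_triangle) (auto simp: cone_rel_def cone_seqs_def)
    thus "(x, z) \<in> cone_rel \<mu> X e \<alpha>" using xy yz by (auto simp: cone_rel_def)
  qed
qed

lemma cone_points_some:
  assumes "ultrafilter \<mu>" "\<forall>k. \<alpha> k > 0" "C \<in> cone_points \<mu> X e \<alpha>"
  shows "(SOME x. x \<in> C) \<in> C" "(SOME x. x \<in> C) \<in> cone_seqs \<mu> X e \<alpha>"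
    "C = cone_rel \<mu> X e \<alpha> `` {SOME x. x \<in> C}"
proof -
  note E = equiv_cone_rel[OF assms(1,2), of X e]
  have C: "C \<in> cone_seqs \<mu> X e \<alpha> // cone_rel \<mu> X e \<alpha>"
    using assms(3) by (simp add: cone_points_def)
  show 1: "(SOME x. x \<in> C) \<in> C" using in_quotient_imp_non_empty[OF E C] by (simp add: some_in_eq)
  show "(SOME x. x \<in> C) \<in> cone_seqs \<mu> X e \<alpha>" using in_quotient_imp_subset[OF E C] 1 by blast
  show "C = cone_rel \<mu> X e \<alpha> `` {SOME x. x \<in> C}"
    using C
  proof (rule quotientE)
    fix a assume a: "C = cone_rel \<mu> X e \<alpha> `` {a}"
    with 1 have "(a, SOME x. x \<in> C) \<in> cone_rel \<mu> X e \<alpha>" by blast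
    from equiv_class_eq[OF E this] show ?thesis unfolding a[symmetric] .
  qed
qed

lemma cone_dist_eq:
  assumes "ultrafilter \<mu>" "\<forall>k. \<alpha> k > 0"
    and "C \<in> cone_points \<mu> X e \<alpha>" "D \<in> cone_points \<mu> X e \<alpha>" "x \<in> C" "y \<in> D"
  shows "cone_dist \<mu> X \<alpha> C D = enn2real (ulim_dist \<mu> X \<alpha> x y)"
proof -
  let ?x = "SOME x. x \<in> C" and ?y = "SOME y. y \<in> D"
  have x: "(?x, x) \<in> cone_rel \<mu> X e \<alpha>" and y: "(?y, y) \<in> cone_rel \<mu> X e \<alpha>"
    using cone_points_some(3)[OF assms(1,2,3)] cone_points_some(3)[OF assms(1,2,4)] assms(5,6)
    by blast+
  hence m: "\<forall>k. ?x k \<in> mspace X" "\<forall>k. x k \<in> mspace X" "\<forall>k. ?y k \<in> mspace X" "\<forall>k. y k \<in> mspace X"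
    and z: "ulim_dist \<mu> X \<alpha> ?x x = 0" "ulim_dist \<mu> X \<alpha> x ?x = 0"
      "ulim_dist \<mu> X \<alpha> ?y y = 0" "ulim_dist \<mu> X \<alpha> y ?y = 0"
    by (auto simp: cone_rel_def cone_seqs_def ulim_dist_commute)
  note T = ulim_dist_triangle[OF assms(1,2)]
  have "ulim_dist \<mu> X \<alpha> ?x ?y = ulim_dist \<mu> X \<alpha> x y"
  proof (rule antisym)
    show "ulim_dist \<mu> X \<alpha> ?x ?y \<le> ulim_dist \<mu> X \<alpha> x y"
      using T[OF m(1,2,3)] T[OF m(2,4,3)] z by simp
    show "ulim_dist \<mu> X \<alpha> x y \<le> ulim_dist \<mu> X \<alpha> ?x ?y"
      using T[OF m(2,1,4)] T[OF m(1,3,4)] z by simp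
  qed
  thus ?thesis by (simp add: cone_dist_def)
qed

lemma Metric_space_cone:
  assumes "ultrafilter \<mu>" "\<forall>k. \<alpha> k > 0" "e \<in> mspace X"
  shows "Metric_space (cone_points \<mu> X e \<alpha>) (cone_dist \<mu> X \<alpha>)"
proof
  fix C D show "0 \<le> cone_dist \<mu> X \<alpha> C D" by (simp add: cone_dist_def)
  show "cone_dist \<mu> X \<alpha> C D = cone_dist \<mu> X \<alpha> D C" by (simp add: cone_dist_def ulim_dist_commute)
next
  fix C D assume CD: "C \<in> cone_points \<mu> X e \<alpha>" "D \<in> cone_points \<mu> X e \<alpha>"
  let ?x = "SOME x. x \<in> C" and ?y = "SOME y. y \<in> D"
  note c = cone_points_some[OF assms(1,2) CD(1)] and d = cone_points_some[OF assms(1,2) CD(2)]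
  have f: "ulim_dist \<mu> X \<alpha> ?x ?y < \<infinity>"
    by (rule ulim_dist_finite[OF assms c(2) d(2)])
  show "cone_dist \<mu> X \<alpha> C D = 0 \<longleftrightarrow> C = D"
  proof
    assume "cone_dist \<mu> X \<alpha> C D = 0"
    hence "ulim_dist \<mu> X \<alpha> ?x ?y = 0" using f by (auto simp: cone_dist_def enn2real_eq_0_iff)
    hence "(?x, ?y) \<in> cone_rel \<mu> X e \<alpha>" using c(2) d(2) by (simp add: cone_rel_def)
    thus "C = D" using c(3) d(3) equiv_class_eq[OF equiv_cone_rel[OF assms(1,2)]] by metis
  next
    assume "C = D"
    thus "cone_dist \<mu> X \<alpha> C D = 0"
      using ulim_dist_refl[OF assms(1), of ?x X \<alpha>] c(2) by (simp add: cone_dist_def cone_seqs_def)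
  qed
next
  fix C D E
  assume CDE: "C \<in> cone_points \<mu> X e \<alpha>" "D \<in> cone_points \<mu> X e \<alpha>" "E \<in> cone_points \<mu> X e \<alpha>"
  note c = cone_points_some(2)[OF assms(1,2) CDE(1)] and d = cone_points_some(2)[OF assms(1,2) CDE(2)]
    and e = cone_points_some(2)[OF assms(1,2) CDE(3)]
  let ?x = "SOME x. x \<in> C" and ?y = "SOME y. y \<in> D" and ?z = "SOME z. z \<in> E"
  have f: "ulim_dist \<mu> X \<alpha> ?x ?y < \<infinity>" "ulim_dist \<mu> X \<alpha> ?y ?z < \<infinity>"
    using ulim_dist_finite[OF assms] c d e by auto
  have "ulim_dist \<mu> X \<alpha> ?x ?z \<le> ulim_dist \<mu> X \<alpha> ?x ?y + ulim_dist \<mu> X \<alpha> ?y ?z"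
    using c d e assms by (intro ulim_dist_triangle) (auto simp: cone_seqs_def)
  hence "enn2real (ulim_dist \<mu> X \<alpha> ?x ?z)
      \<le> enn2real (ulim_dist \<mu> X \<alpha> ?x ?y + ulim_dist \<mu> X \<alpha> ?y ?z)"
    using f by (intro enn2real_mono) auto
  also have "\<dots> = enn2real (ulim_dist \<mu> X \<alpha> ?x ?y) + enn2real (ulim_dist \<mu> X \<alpha> ?y ?z)"
    using f by (intro enn2real_plus) auto
  finally show "cone_dist \<mu> X \<alpha> C E \<le> cone_dist \<mu> X \<alpha> C D + cone_dist \<mu> X \<alpha> D E"
    by (simp add: cone_dist_def)
qed

lemma mspace_cone:
  assumes "ultrafilter \<mu>" "\<forall>k. \<alpha> k > 0" "e \<in> mspace X"
  shows "mspace (cone \<mu> X e \<alpha>) = cone_points \<mu> X e \<alpha>"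
  unfolding cone_def by (rule Metric_space.mspace_metric[OF Metric_space_cone[OF assms]])

lemma mdist_cone:
  assumes "ultrafilter \<mu>" "\<forall>k. \<alpha> k > 0" "e \<in> mspace X"
    and "C \<in> cone_points \<mu> X e \<alpha>" "D \<in> cone_points \<mu> X e \<alpha>" "x \<in> C" "y \<in> D"
  shows "mdist (cone \<mu> X e \<alpha>) C D = enn2real (ulim_dist \<mu> X \<alpha> x y)"
  unfolding cone_def Metric_space.mdist_metric[OF Metric_space_cone[OF assms(1-3)]]
  using assms by (intro cone_dist_eq)

lemma cone_base_in_mspace:
  assumes "ultrafilter \<mu>" "\<forall>k. \<alpha> k > 0" "e \<in> mspace X"
  shows "cone_base \<mu> X e \<alpha> \<in> mspace (cone \<mu> X e \<alpha>)"
proof -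
  have "(\<lambda>_. e) \<in> cone_seqs \<mu> X e \<alpha>"
    using assms ulim_dist_refl[of \<mu> "\<lambda>_. e" X \<alpha>] by (simp add: cone_seqs_def)
  thus ?thesis unfolding mspace_cone[OF assms] cone_points_def cone_base_def by (rule quotientI)
qed

lemma Metric_space_copy:
  assumes "inj_on f (mspace X)"
  shows "Metric_space (f ` mspace X)
    (\<lambda>p q. mdist X (inv_into (mspace X) f p) (inv_into (mspace X) f q))"
  using assms by unfold_locales (auto simp: mdist_commute inj_on_eq_iff intro: mdist_triangle)

lemma
  assumes "inj_on f (mspace X)"
  shows mspace_metric_copy: "mspace (metric_copy f X) = f ` mspace X"
    and mdist_metric_copy: "\<lbrakk>x \<in> mspace X; y \<in> mspace X\<rbrakk> \<Longrightarrow>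
      mdist (metric_copy f X) (f x) (f y) = mdist X x y"
  using assms unfolding metric_copy_def
    Metric_space.mspace_metric[OF Metric_space_copy[OF assms]]
    Metric_space.mdist_metric[OF Metric_space_copy[OF assms]] by auto

lemma inj_on_class_name:
  assumes "ultrafilter \<mu>" "\<forall>k. \<alpha> k > 0" "e \<in> mspace X"
  shows "inj_on class_name (mspace (cone \<mu> X e \<alpha>))"
  unfolding mspace_cone[OF assms]
proof (rule inj_onI)
  fix C D assume CD: "C \<in> cone_points \<mu> X e \<alpha>" "D \<in> cone_points \<mu> X e \<alpha>"
    and eq: "class_name C = class_name D"
  show "C = D"
    using cone_points_some(3)[OF assms(1,2) CD(1)] cone_points_some(3)[OF assms(1,2) CD(2)] eq
    by (simp add: class_name_def)
qed

lemma iter_base_in_mspace: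
  assumes "ultrafilter \<mu>" "\<forall>n. scaling_factor (\<alpha> n)" "e \<in> mspace X"
  shows "iter_base \<mu> X e \<alpha> i \<in> mspace (iter_cone \<mu> X e \<alpha> i)"
proof (induction i)
  case 0
  have "inj_on Point (mspace X)" by (auto simp: inj_on_def)
  thus ?case using assms by (simp add: iter_base_def iter_cone_def mspace_metric_copy)
next
  case (Suc i)
  have a: "\<forall>k. \<alpha> (Suc i) k > 0" using assms(2) by (simp add: scaling_factor_def)
  show ?case
    using mspace_metric_copy[OF inj_on_class_name[OF assms(1) a Suc]]
      cone_base_in_mspace[OF assms(1) a Suc]
    by (simp add: iter_base_def iter_cone_def split_beta)
qed

text \<open>
  The zeroth iterated cone is \<open>X\<close>, and each further one is the cone of the preceding one, up to
  a surjective isometry preserving the basepoint.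
\<close>

lemma iter_cone_0_isometric:
  shows "Point ` mspace X = mspace (iter_cone \<mu> X e \<alpha> 0)"
    and "\<lbrakk>x \<in> mspace X; y \<in> mspace X\<rbrakk> \<Longrightarrow>
      mdist (iter_cone \<mu> X e \<alpha> 0) (Point x) (Point y) = mdist X x y"
    and "iter_base \<mu> X e \<alpha> 0 = Point e"
proof -
  have "inj_on Point (mspace X)" by (auto simp: inj_on_def)
  thus "Point ` mspace X = mspace (iter_cone \<mu> X e \<alpha> 0)"
    and "\<lbrakk>x \<in> mspace X; y \<in> mspace X\<rbrakk> \<Longrightarrow>
      mdist (iter_cone \<mu> X e \<alpha> 0) (Point x) (Point y) = mdist X x y"
    by (simp_all add: iter_cone_def mspace_metric_copy mdist_metric_copy)
qed (simp add: iter_base_def)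

lemma iter_cone_Suc_isometric:
  fixes X :: "'a metric"
  assumes "ultrafilter \<mu>" "\<forall>n. scaling_factor (\<alpha> n)" "e \<in> mspace X"
  defines "C \<equiv> \<lambda>i. cone \<mu> (iter_cone \<mu> X e \<alpha> i) (iter_base \<mu> X e \<alpha> i) (\<alpha> (Suc i))"
  shows "bij_betw class_name (mspace (C i)) (mspace (iter_cone \<mu> X e \<alpha> (Suc i)))"
    and "\<lbrakk>p \<in> mspace (C i); q \<in> mspace (C i)\<rbrakk> \<Longrightarrow>
      mdist (iter_cone \<mu> X e \<alpha> (Suc i)) (class_name p) (class_name q) = mdist (C i) p q"
    and "iter_base \<mu> X e \<alpha> (Suc i) =
      class_name (cone_base \<mu> (iter_cone \<mu> X e \<alpha> i) (iter_base \<mu> X e \<alpha> i) (\<alpha> (Suc i)))"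
proof -
  have a: "\<forall>k. \<alpha> (Suc i) k > 0" using assms(2) by (simp add: scaling_factor_def)
  have inj: "inj_on class_name (mspace (C i))" unfolding C_def
    by (rule inj_on_class_name[OF assms(1) a iter_base_in_mspace[OF assms(1-3)]])
  have eq: "iter_cone \<mu> X e \<alpha> (Suc i) = metric_copy class_name (C i)"
    by (simp add: C_def iter_cone_def iter_base_def split_beta)
  show "bij_betw class_name (mspace (C i)) (mspace (iter_cone \<mu> X e \<alpha> (Suc i)))"
    using inj by (simp add: bij_betw_def eq mspace_metric_copy)
  show "\<lbrakk>p \<in> mspace (C i); q \<in> mspace (C i)\<rbrakk> \<Longrightarrow>
      mdist (iter_cone \<mu> X e \<alpha> (Suc i)) (class_name p) (class_name q) = mdist (C i) p q"
    using inj by (simp add: eq mdist_metric_copy)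
  show "iter_base \<mu> X e \<alpha> (Suc i) =
      class_name (cone_base \<mu> (iter_cone \<mu> X e \<alpha> i) (iter_base \<mu> X e \<alpha> i) (\<alpha> (Suc i)))"
    by (simp add: iter_cone_def iter_base_def split_beta)
qed

end

theory Submission
  imports Defs
begin

text \<open>
  All spaces are subsets of the half-line, pointed at \<open>0\<close>, and all scaling factors are one rapidly
  growing sequence \<open>\<beta>\<close>. A closed set \<open>Z\<close> containing \<open>0\<close> is the cone of the union of any bounded set
  containing \<open>0\<close> with the integer set \<open>\<Union>n. \<beta> n * F n\<close>, where \<open>F n\<close> consists of the
  points of \<open>Z \<inter> [1/(n+1), n+1]\<close> rounded down to multiples of \<open>1/(n+1)\<close>: at scale \<open>\<beta> n\<close> only the \<open>n\<close>-th piece is visible, so the limit exists in the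
  ordinary sense and no choice of ultrafilter matters. Hence there are sets \<open>Y i\<close>, given by one
  inductive definition, such that \<open>Y i\<close> is the union of \<open>a i\<close> disjoint compact intervals and an
  infinite set of integers, and the cone of \<open>Y i\<close> is \<open>Y (i + 1)\<close>. The number of nondegenerate
  intervals determines the topology of \<open>Y i\<close>.
\<close>

section \<open>Cones of subsets of the half-line\<close>

text \<open>A non-principal ultrafilter contains the complement of each point, hence of each initial
  segment. What holds for all large \<open>k\<close> therefore holds \<mu>-almost everywhere,
  whichever \<mu> is given.\<close>

lemma nonprincipal_ultrafilter_le_sequentially:
  assumes "nonprincipal_ultrafilter \<mu>"
  shows "\<mu> \<le> sequentially"
proof (rule filter_leI)
  fix P :: "nat \<Rightarrow> bool" assume "eventually P sequentially"
  then obtain N where N: "\<And>k. N \<le> k \<Longrightarrow> P k"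
    by (auto simp: eventually_sequentially)
  have "eventually (\<lambda>k. k \<noteq> n) \<mu>" for n
    using assms by (auto simp: nonprincipal_ultrafilter_def ultrafilter_def)
  hence "eventually (\<lambda>k. \<forall>n\<in>{..<N}. k \<noteq> n) \<mu>"
    by (intro eventually_ball_finite) auto
  thus "eventually P \<mu>"
    by (rule eventually_mono) (metis N lessThan_iff not_le)
qed

text \<open>Injectivity of \<open>f\<close> follows from the distance formula. Taking cones changes
  the type, so spaces are compared through their images in the reals.\<close>

definition pointed_isometric :: "'a metric \<Rightarrow> 'a \<Rightarrow> real set \<Rightarrow> bool" where
  "pointed_isometric M p S \<longleftrightarrow> p \<in> mspace M \<and>
     (\<exists>f. f ` mspace M = S \<and> f p = 0 \<and>
       (\<forall>x\<in>mspace M. \<forall>y\<in>mspace M. mdist M x y = \<bar>f x - f y\<bar>))"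

lemma pointed_isometric_homeomorphic:
  assumes "pointed_isometric M p S"
  shows "mtopology_of M homeomorphic_space top_of_set S"
proof -
  obtain f where f: "f ` mspace M = S"
    and d: "\<And>x y. x \<in> mspace M \<Longrightarrow> y \<in> mspace M \<Longrightarrow> mdist M x y = \<bar>f x - f y\<bar>"
    using assms by (auto simp: pointed_isometric_def)
  let ?E = "submetric euclidean_metric S"
  interpret Metric_space12 "mspace M" "mdist M" "mspace ?E" "mdist ?E"
    by (intro Metric_space12.intro Metric_space_mspace_mdist)
  have "homeomorphic_map (mtopology_of M) (mtopology_of ?E) f"
    using isometry_imp_homeomorphic_map[of f] f d by (auto simp: mtopology_of_def dist_real_def)
  thus ?thesis
    by (metis homeomorphic_map_imp_homeomorphic_space mtopology_of_submetric mtopology_of_euclidean)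
qed

text \<open>On the half-line the distance to the basepoint is already an isometry.\<close>

lemma cone_pointed_isometric:
  assumes u: "ultrafilter \<mu>" and b: "\<forall>k. \<beta> k > 0" and iso: "pointed_isometric M p S"
    and S: "S \<subseteq> {0..}"
  shows "pointed_isometric (cone \<mu> M p \<beta>) (cone_base \<mu> M p \<beta>)
           {t. \<exists>y. (\<forall>k. y k \<in> S) \<and> ((\<lambda>k. y k / \<beta> k) \<longlongrightarrow> t) \<mu>}"
    (is "pointed_isometric ?C ?p ?T")
proof -
  obtain f where f: "f ` mspace M = S" "f p = 0" and p: "p \<in> mspace M"
    and d: "\<And>x y. x \<in> mspace M \<Longrightarrow> y \<in> mspace M \<Longrightarrow> mdist M x y = \<bar>f x - f y\<bar>"
    using iso by (auto simp: pointed_isometric_def)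
  have nb: "\<mu> \<noteq> bot" using u by (simp add: ultrafilter_def)
  have f0: "f x \<ge> 0" if "x \<in> mspace M" for x using f(1) S that by force
  have dp: "mdist M x p = f x" if "x \<in> mspace M" for x using d[OF that p] f0[OF that] f(2) by simp
  note E = equiv_cone_rel[OF u b, of M p]
  define h where "h C = mdist ?C C ?p" for C
  have base: "(\<lambda>_. p) \<in> cone_seqs \<mu> M p \<beta>"
    using p ulim_dist_refl[OF u, of "\<lambda>_. p" M \<beta>] by (simp add: cone_seqs_def)
  have basein: "(\<lambda>_. p) \<in> ?p"
    unfolding cone_base_def using equiv_class_self[OF E base] .
  have pC: "?p \<in> mspace ?C" by (rule cone_base_in_mspace[OF u b p])
  \<comment> \<open>Members of a class have finite extended limit, so it can be read as a limit of
    reals.\<close>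
  have lim: "((\<lambda>k. f (x k) / \<beta> k) \<longlongrightarrow> h C) \<mu>"
    if C: "C \<in> cone_points \<mu> M p \<beta>" and x: "x \<in> C" for C x
  proof -
    have xs: "x \<in> cone_seqs \<mu> M p \<beta>"
      using in_quotient_imp_subset[OF E] C x unfolding cone_points_def by blast
    have eq: "h C = enn2real (ulim_dist \<mu> M \<beta> x (\<lambda>_. p))"
      unfolding h_def using mdist_cone[OF u b p C _ x basein] pC
      by (simp add: mspace_cone[OF u b p])
    have fin: "ulim_dist \<mu> M \<beta> x (\<lambda>_. p) < \<infinity>" and xm: "\<And>k. x k \<in> mspace M"
      using xs by (auto simp: cone_seqs_def)
    have "((\<lambda>k. ennreal (mdist M (x k) p / \<beta> k)) \<longlongrightarrow> ulim_dist \<mu> M \<beta> x (\<lambda>_. p)) \<mu>"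
      unfolding ulim_dist_def by (rule ultrafilter_tendsto_Lim[OF u])
    hence "((\<lambda>k. ennreal (f (x k) / \<beta> k)) \<longlongrightarrow> ennreal (h C)) \<mu>"
      using fin by (simp add: eq dp xm)
    thus ?thesis
      by (rule tendsto_ennrealD) (use f0 xm b in \<open>auto simp: h_def less_imp_le\<close>)
  qed
  \<comment> \<open>Both coordinates converge separately, and on the line distance is the absolute
    difference of coordinates, so the limit passes inside.\<close>
  have dist: "mdist ?C C D = \<bar>h C - h D\<bar>"
    if C: "C \<in> cone_points \<mu> M p \<beta>" and D: "D \<in> cone_points \<mu> M p \<beta>" for C D
  proof -
    define x where "x = (SOME x. x \<in> C)"
    define y where "y = (SOME y. y \<in> D)"
    have x: "x \<in> C" "x \<in> cone_seqs \<mu> M p \<beta>" and y: "y \<in> D" "y \<in> cone_seqs \<mu> M p \<beta>"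
      unfolding x_def y_def using cone_points_some[OF u b C] cone_points_some[OF u b D] by auto
    have xm: "\<And>k. x k \<in> mspace M" "\<And>k. y k \<in> mspace M"
      using x y by (auto simp: cone_seqs_def)
    have "((\<lambda>k. \<bar>f (x k) / \<beta> k - f (y k) / \<beta> k\<bar>) \<longlongrightarrow> \<bar>h C - h D\<bar>) \<mu>"
      by (intro tendsto_intros lim[OF C x(1)] lim[OF D y(1)])
    moreover have "\<bar>f (x k) / \<beta> k - f (y k) / \<beta> k\<bar> = mdist M (x k) (y k) / \<beta> k" for k
    proof -
      have "\<beta> k > 0" using b by blast
      thus ?thesis by (simp add: d xm flip: diff_divide_distrib)
    qed
    ultimately have "((\<lambda>k. ennreal (mdist M (x k) (y k) / \<beta> k)) \<longlongrightarrow> ennreal \<bar>h C - h D\<bar>) \<mu>"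
      by (intro tendsto_ennrealI) simp
    hence "ulim_dist \<mu> M \<beta> x y = ennreal \<bar>h C - h D\<bar>"
      unfolding ulim_dist_def by (rule tendsto_Lim[OF nb])
    thus ?thesis using mdist_cone[OF u b p C D x(1) y(1)] by simp
  qed
  have "h ` cone_points \<mu> M p \<beta> = ?T"
  proof (intro equalityI subsetI)
    fix t assume "t \<in> h ` cone_points \<mu> M p \<beta>"
    then obtain C where C: "C \<in> cone_points \<mu> M p \<beta>" and t: "t = h C" by blast
    define x where "x = (SOME x. x \<in> C)"
    have x: "x \<in> C" "x \<in> cone_seqs \<mu> M p \<beta>"
      unfolding x_def using cone_points_some[OF u b C] by auto
    have "\<forall>k. f (x k) \<in> S" using x(2) f(1) by (auto simp: cone_seqs_def)
    thus "t \<in> ?T" using lim[OF C x(1)] t by (intro CollectI exI[of _ "\<lambda>k. f (x k)"]) simp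
  next
    fix t assume "t \<in> ?T"
    then obtain y where yS: "\<And>k. y k \<in> S" and y: "((\<lambda>k. y k / \<beta> k) \<longlongrightarrow> t) \<mu>" by blast
    have "\<forall>k. \<exists>x. x \<in> mspace M \<and> f x = y k"
      using yS f(1) by (metis imageE)
    then obtain x where x: "\<And>k. x k \<in> mspace M" "\<And>k. f (x k) = y k" by metis
    \<comment> \<open>The finite limit \<open>t\<close> makes the lift \<open>x\<close> of
      \<open>y\<close> admissible in the cone; uniqueness of limits then gives its class the
      coordinate \<open>t\<close>.\<close>
    have "((\<lambda>k. ennreal (y k / \<beta> k)) \<longlongrightarrow> ennreal t) \<mu>" by (rule tendsto_ennrealI[OF y])
    hence "ulim_dist \<mu> M \<beta> x (\<lambda>_. p) = ennreal t"
      unfolding ulim_dist_def by (intro tendsto_Lim[OF nb]) (simp add: dp x)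
    hence xs: "x \<in> cone_seqs \<mu> M p \<beta>" using x(1) by (simp add: cone_seqs_def)
    let ?D = "cone_rel \<mu> M p \<beta> `` {x}"
    have D: "?D \<in> cone_points \<mu> M p \<beta>" unfolding cone_points_def by (rule quotientI[OF xs])
    have "((\<lambda>k. f (x k) / \<beta> k) \<longlongrightarrow> h ?D) \<mu>"
      by (rule lim[OF D equiv_class_self[OF E xs]])
    hence "h ?D = t" using y tendsto_unique[OF nb] by (simp add: x)
    thus "t \<in> h ` cone_points \<mu> M p \<beta>" using D by blast
  qed
  moreover have "h ?p = 0" unfolding h_def using pC by simp
  ultimately show ?thesis
    unfolding pointed_isometric_def using pC dist by (auto simp: mspace_cone[OF u b p])
qed

text \<open>Serves to pass from a space or cone to its copy under \<open>Point\<close> or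
  \<open>class_name\<close>: the coordinate is composed with the inverse of
  \<open>g\<close>.\<close>

lemma pointed_isometric_transfer:
  assumes iso: "pointed_isometric M p S" and g: "bij_betw g (mspace M) (mspace N)"
    and d: "\<And>x y. x \<in> mspace M \<Longrightarrow> y \<in> mspace M \<Longrightarrow> mdist N (g x) (g y) = mdist M x y"
  shows "pointed_isometric N (g p) S"
proof -
  obtain f where f: "f ` mspace M = S" "f p = 0" and p: "p \<in> mspace M"
    and df: "\<And>x y. x \<in> mspace M \<Longrightarrow> y \<in> mspace M \<Longrightarrow> mdist M x y = \<bar>f x - f y\<bar>"
    using iso by (auto simp: pointed_isometric_def)
  let ?h = "f \<circ> inv_into (mspace M) g"
  have h: "?h (g x) = f x" if "x \<in> mspace M" for x
    using that g by (simp add: bij_betw_def)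
  have N: "mspace N = g ` mspace M" using g by (simp add: bij_betw_def)
  have "?h ` mspace N = S" unfolding N image_image using h f(1) by (metis (no_types, lifting) image_cong)
  moreover have "?h (g p) = 0" by (simp only: h[OF p] f(2))
  moreover have "\<forall>x\<in>mspace N. \<forall>y\<in>mspace N. mdist N x y = \<bar>?h x - ?h y\<bar>"
    unfolding N using d df h by simp
  ultimately show ?thesis using p N unfolding pointed_isometric_def by blast
qed

text \<open>By induction the tower of cones becomes a sequence of real sets: each step takes
  rescaled limits, then transfers along \<open>class_name\<close>. What remains is to find sets that
  satisfy the recursion \<open>Suc\<close>.\<close>

lemma iter_cone_pointed_isometric:
  assumes u: "ultrafilter \<mu>" and \<alpha>: "\<forall>n. scaling_factor (\<alpha> n)"
    and 0: "pointed_isometric X e (Y 0)" and pos: "\<And>i. Y i \<subseteq> {0..}"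
    and Suc: "\<And>i. {t. \<exists>y. (\<forall>k. y k \<in> Y i) \<and> ((\<lambda>k. y k / \<alpha> (Suc i) k) \<longlongrightarrow> t) \<mu>} = Y (Suc i)"
  shows "pointed_isometric (iter_cone \<mu> X e \<alpha> i) (iter_base \<mu> X e \<alpha> i) (Y i)"
proof (induction i)
  case 0
  show ?case unfolding iter_cone_0_isometric(3)
    by (rule pointed_isometric_transfer[OF assms(3)])
      (auto simp: bij_betw_def inj_on_def iter_cone_0_isometric)
next
  case (Suc i)
  have e: "e \<in> mspace X" using 0 by (simp add: pointed_isometric_def)
  have "\<forall>k. \<alpha> (Suc i) k > 0" using \<alpha> by (simp add: scaling_factor_def)
  from cone_pointed_isometric[OF u this Suc pos] show ?case
    unfolding assms(5) iter_cone_Suc_isometric(3)[OF u \<alpha> e]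
    by (rule pointed_isometric_transfer) (use iter_cone_Suc_isometric[OF u \<alpha> e] in auto)
qed

section \<open>A tower of closed subsets of the half-line\<close>

text \<open>Integral, so that natural multiples stay natural. The cube makes the growth beat the
  ratio between the bounds \<open>mesh n\<close> and \<open>(n + 1)^2 * mesh n\<close> of the
  \<open>n\<close>-th copied piece.\<close>

definition mesh :: "nat \<Rightarrow> real" where
  "mesh n = fact (Suc n) ^ 3"

text \<open>In units of \<open>scale n\<close> the step \<open>mesh n\<close> is
  \<open>1 / (n + 1)\<close>, so the rounding error vanishes in the limit.\<close>

definition scale :: "nat \<Rightarrow> real" where
  "scale n = real (Suc n) * mesh n"

text \<open>Layer \<open>i\<close> refers to layer \<open>i + 1\<close>, so recursion on
  \<open>i\<close> has no starting point; a least set of pairs defines all layers at once. The point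
  1 is a seed whose copies \<open>scale n\<close> make every layer infinite. The lower bound in
  \<open>copy\<close> keeps the floor at least 1, and both bounds widen with \<open>n\<close> to
  reach every positive \<open>z\<close>.\<close>

inductive_set level :: "(nat \<Rightarrow> nat) \<Rightarrow> (nat \<times> real) set" for a where
  zero: "(i, 0) \<in> level a"
| one: "(i, 1) \<in> level a"
| interval: "m < a i \<Longrightarrow> x \<in> {2 * real m + 2..2 * real m + 3} \<Longrightarrow> (i, x) \<in> level a"
| copy: "(Suc i, z) \<in> level a \<Longrightarrow> 1 \<le> real (Suc n) * z \<Longrightarrow> z \<le> real (Suc n) \<Longrightarrow>
    (i, mesh n * of_int \<lfloor>real (Suc n) * z\<rfloor>) \<in> level a"

definition layer :: "(nat \<Rightarrow> nat) \<Rightarrow> nat \<Rightarrow> real set" where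
  "layer a i = {x. (i, x) \<in> level a}"

definition blocks :: "nat \<Rightarrow> real set" where
  "blocks n = (\<Union>m<n. {2 * real m + 2..2 * real m + 3})"

section \<open>Growth of the mesh and of the scaling factor\<close>

lemma mesh_ge_1: "mesh n \<ge> 1"
  unfolding mesh_def by (intro one_le_power fact_ge_1)

lemma mesh_Nats: "mesh n \<in> \<nat>"
  unfolding mesh_def by (metis of_nat_fact of_nat_in_Nats of_nat_power)

text \<open>From \<open>(n + 1)! \<le> k!\<close> the factorial gains a factor \<open>k + 1\<close>,
  which is then cubed.\<close>

lemma mesh_growth:
  assumes "n < k"
  shows "mesh n * real (Suc k) ^ 3 \<le> mesh k"
proof -
  have "fact (Suc n) \<le> (fact k :: real)" using assms by (intro fact_mono) auto
  hence "real (Suc k) * fact (Suc n) \<le> fact (Suc k)" by (simp del: of_nat_Suc)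
  hence "(real (Suc k) * fact (Suc n)) ^ 3 \<le> fact (Suc k) ^ 3"
    by (intro power_mono) (auto simp del: of_nat_Suc)
  thus ?thesis by (simp add: mesh_def power_mult_distrib mult.commute del: of_nat_Suc)
qed

lemma scaling_factor_scale: "scaling_factor scale"
  unfolding scaling_factor_def
proof
  show "\<forall>k. scale k > 0"
    unfolding scale_def by (intro allI mult_pos_pos less_le_trans[OF zero_less_one mesh_ge_1]) simp
  have "real k \<le> scale k" for k
    using mult_mono[OF _ mesh_ge_1[of k], of "real k" "real (Suc k)"] by (simp add: scale_def)
  thus "filterlim scale at_top sequentially"
    by (intro filterlim_at_top_mono[OF filterlim_real_sequentially]) simp
qed

section \<open>Shape of a single layer\<close>

lemma layer_cases:
  assumes "x \<in> layer a i"
  obtains "x = 0" | "x = 1" | "x \<in> blocks (a i)"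
  | z n where "z \<in> layer a (Suc i)" "1 \<le> real (Suc n) * z" "z \<le> real (Suc n)"
      "x = mesh n * of_int \<lfloor>real (Suc n) * z\<rfloor>"
  using assms unfolding layer_def mem_Collect_eq
  by (cases rule: level.cases) (auto simp: blocks_def)

lemma blocks_subset_layer: "blocks (a i) \<subseteq> layer a i"
  by (auto simp: blocks_def layer_def intro!: level.interval)

lemma of_int_floor_Nats:
  assumes "0 \<le> x"
  shows "of_int \<lfloor>x\<rfloor> \<in> \<nat>"
proof -
  have "0 \<le> \<lfloor>x\<rfloor>" using assms by simp
  then obtain l where "\<lfloor>x\<rfloor> = int l" using nonneg_int_cases by blast
  thus ?thesis by simp
qed

text \<open>A copied point is a product of two naturals. That all points outside the intervals are
  integers later gives both closedness and discreteness.\<close>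

lemma layer_subset: "layer a i \<subseteq> \<nat> \<union> blocks (a i)"
proof
  fix x assume "x \<in> layer a i"
  thus "x \<in> \<nat> \<union> blocks (a i)"
  proof (cases rule: layer_cases)
    case (4 z n)
    have "(of_int \<lfloor>real (Suc n) * z\<rfloor> :: real) \<in> \<nat>"
      by (rule of_int_floor_Nats) (use 4(2) in linarith)
    thus ?thesis using 4 mesh_Nats by auto
  qed auto
qed

lemma blocks_bounds: "blocks n \<subseteq> {2..2 * real n + 1}"
  by (force simp: blocks_def)

lemma layer_nonneg: "layer a i \<subseteq> {0..}"
  using layer_subset[of a i] blocks_bounds[of "a i"] by (force simp: Nats_def)

lemma closed_blocks: "closed (blocks n)"
  unfolding blocks_def by (intro closed_UN) auto

text \<open>Every set of integers is closed, and the blocks are a finite union of closed intervals.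
  Closedness keeps limits of rescaled points inside the next layer.\<close>

lemma closed_layer: "closed (layer a i)"
proof -
  have "layer a i = (layer a i \<inter> \<nat>) \<union> blocks (a i)"
    using layer_subset blocks_subset_layer by blast
  moreover have "closed (layer a i \<inter> \<nat>)"
    by (rule closed_subset_Ints) (use Nats_subset_Ints in auto)
  ultimately show ?thesis using closed_blocks by (metis closed_Un)
qed

text \<open>This is the \<open>n\<close>-th copy of the seed 1, for which rounding is exact.\<close>

lemma scale_in_layer: "scale n \<in> layer a i"
proof -
  have "(i, mesh n * of_int \<lfloor>real (Suc n) * 1\<rfloor>) \<in> level a"
    by (rule level.copy[OF level.one]) auto
  moreover have "of_int \<lfloor>real (Suc n) * 1\<rfloor> = real (Suc n)"
    by (metis floor_of_nat mult.right_neutral of_int_of_nat_eq)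
  ultimately show ?thesis by (simp add: layer_def scale_def mult.commute)
qed

text \<open>The growth of \<^const>\<open>mesh\<close> forces \<open>n = k\<close> in the last clause of \<^const>\<open>level\<close>.\<close>

lemma layer_at_scale:
  assumes x: "x \<in> layer a i" and K: "1 / real (Suc k) < x / scale k" "x / scale k < real (Suc k)"
    and k: "2 * a i + 1 \<le> k"
  obtains z where "z \<in> layer a (Suc i)" "\<bar>x / scale k - z\<bar> \<le> 1 / real (Suc k)"
proof -
  define K where "K = real (Suc k)"
  have K1: "K \<ge> 1" by (simp add: K_def)
  have sc: "scale k = K * mesh k" by (simp add: scale_def K_def)
  have mk: "mesh k \<ge> 1" by (rule mesh_ge_1)
  have mp: "mesh k > 0" using mk by simp
  \<comment> \<open>The hypotheses put \<open>x\<close> in the window between the bounds of the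
    \<open>k\<close>-th copied piece.\<close>
  have x1: "mesh k < x" and x2: "x < K * K * mesh k"
    using K K1 mp unfolding sc K_def[symmetric] by (auto simp: field_simps)
  have xk: "x > 1" using x1 mk by simp
  \<comment> \<open>With the bound on \<open>a i\<close>, this puts the window beyond all the
    intervals.\<close>
  have "K \<le> mesh k"
  proof -
    have "real (Suc k) \<le> fact (Suc k)" using fact_ge_self[of "Suc k"] by (metis of_nat_fact of_nat_le_iff)
    also have "\<dots> \<le> fact (Suc k) ^ 3" by (rule self_le_power) (auto simp: fact_ge_1 simp del: fact_Suc)
    finally show ?thesis by (simp add: K_def mesh_def)
  qed
  from x show ?thesis
  proof (cases rule: layer_cases)
    case 3
    hence "x \<le> 2 * real (a i) + 1" using blocks_bounds[of "a i"] by auto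
    also have "\<dots> \<le> K" using k by (simp add: K_def)
    finally show ?thesis using \<open>K \<le> mesh k\<close> x1 by simp
  next
    case (4 z n)
    define N where "N = real (Suc n)"
    define q where "q = (of_int \<lfloor>N * z\<rfloor> :: real)"
    have N1: "N \<ge> 1" by (simp add: N_def)
    have mn: "mesh n \<ge> 1" by (rule mesh_ge_1)
    have xq: "x = mesh n * q" using 4(4) by (simp add: q_def N_def)
    have q: "q \<le> N * z" "N * z < q + 1" unfolding q_def by linarith+
    have q1: "q \<ge> 1" using 4(2) unfolding q_def N_def by (metis le_floor_iff of_int_1 of_int_le_iff)
    have "q \<le> N * N" using q(1) mult_left_mono[OF 4(3), of N] N1 unfolding N_def by linarith
    \<comment> \<open>A piece of smaller index ends below the window and one of larger index starts
      above it; for index \<open>k\<close> the claim is the bound on the rounding error.\<close>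
    consider "n < k" | "k < n" | "n = k" by linarith
    thus ?thesis
    proof cases
      case 1
      hence "N \<le> K" by (simp add: N_def K_def)
      hence "q \<le> K * K" using \<open>q \<le> N * N\<close> N1 mult_mono[of N K N K] by simp
      hence "x \<le> mesh n * (K * K)" using mn by (simp add: xq)
      also have "\<dots> \<le> mesh n * K ^ 3"
        using mn K1 by (simp add: power3_eq_cube mult_left_mono)
      also have "\<dots> \<le> mesh k" using mesh_growth[OF 1] by (simp add: K_def)
      finally show ?thesis using x1 by simp
    next
      case 2
      hence "K \<le> N" by (simp add: N_def K_def)
      have "mesh k * (K * K) \<le> mesh k * K ^ 3"
        using mk K1 by (simp add: power3_eq_cube mult_left_mono)
      also have "\<dots> \<le> mesh k * N ^ 3"
        using mk K1 \<open>K \<le> N\<close> by (simp add: power_mono)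
      also have "\<dots> \<le> mesh n" using mesh_growth[OF 2] by (simp add: N_def)
      also have "\<dots> \<le> x" using q1 mn by (simp add: xq)
      finally show ?thesis using x2 by (simp add: mult_ac)
    next
      case 3
      hence "x / scale k = q / K" using mp by (simp add: xq sc)
      moreover have "\<bar>q / K - z\<bar> \<le> 1 / K"
      proof -
        have "q / K - z = (q - N * z) / K" using 3 K1 by (simp add: N_def K_def field_simps)
        moreover have "\<bar>q - N * z\<bar> \<le> 1" using q by linarith
        ultimately show ?thesis using K1 by (simp add: abs_divide divide_right_mono)
      qed
      ultimately show ?thesis using that 4(1) by (simp add: K_def)
    qed
  qed (use xk in auto)
qed

section \<open>Rescaled limits of a layer\<close>

lemma tendsto_inverse_Suc: "((\<lambda>k. 1 / real (Suc k)) \<longlongrightarrow> 0) sequentially"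
  using LIMSEQ_inverse_real_of_nat by (simp add: inverse_eq_divide)

text \<open>A limit of rescaled points is approximated by points of the next layer, which is closed.
  Conversely, rounding a fixed point at every scale gives a sequence whose rescaling tends to
  it.\<close>

lemma layer_rescaled_limits:
  assumes nb: "\<mu> \<noteq> bot" and le: "\<mu> \<le> sequentially"
  shows "{t. \<exists>y. (\<forall>k. y k \<in> layer a i) \<and> ((\<lambda>k. y k / scale k) \<longlongrightarrow> t) \<mu>} = layer a (Suc i)"
    (is "?T = _")
proof (intro equalityI subsetI)
  have sp: "scale k > 0" for k using scaling_factor_scale by (simp add: scaling_factor_def)
  note ev = filter_leD[OF le]
  have inv: "((\<lambda>k. 1 / real (Suc k)) \<longlongrightarrow> 0) \<mu>"
    using tendsto_inverse_Suc le by (rule tendsto_mono[rotated])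
  have top: "filterlim (\<lambda>k. real (Suc k)) at_top \<mu>"
    using filterlim_mono[OF _ order_refl le] filterlim_real_sequentially filterlim_sequentially_Suc by metis
  show "t \<in> layer a (Suc i)" if "t \<in> ?T" for t
  proof -
    from that obtain y where y: "\<And>k. y k \<in> layer a i" and lim: "((\<lambda>k. y k / scale k) \<longlongrightarrow> t) \<mu>" by blast
    have "y k / scale k \<ge> 0" for k
      using y[of k] layer_nonneg[of a i] sp[of k] by (auto simp: less_imp_le)
    hence "t \<ge> 0" by (intro tendsto_lowerbound[OF lim _ nb]) simp
    show ?thesis
    \<comment> \<open>Zero is treated apart because \<open>layer_at_scale\<close> needs rescaled
      points bounded away from 0.\<close>
    proof (cases "t = 0")
      case True
      thus ?thesis by (simp add: layer_def level.zero)
    next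
      case False
      hence t: "t > 0" using \<open>t \<ge> 0\<close> by simp
      have "\<exists>z\<in>layer a (Suc i). dist z t < \<epsilon>" if "\<epsilon> > 0" for \<epsilon>
      proof -
        have "\<forall>\<^sub>F k in \<mu>. y k / scale k > t / 2" "\<forall>\<^sub>F k in \<mu>. y k / scale k < 2 * t"
          using order_tendstoD(1)[OF lim, of "t / 2"] order_tendstoD(2)[OF lim, of "2 * t"] t by auto
        \<comment> \<open>The bound \<open>t / 2\<close> opens the window of
          \<open>layer_at_scale\<close> from below; \<open>\<epsilon> / 2\<close> pays for rounding,
          and the other half for the convergence of \<open>y\<close>.\<close>
        moreover have "\<forall>\<^sub>F k in \<mu>. 1 / real (Suc k) < min (t / 2) (\<epsilon> / 2)"
          using order_tendstoD(2)[OF inv, of "min (t / 2) (\<epsilon> / 2)"] t \<open>\<epsilon> > 0\<close> by simp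
        moreover have "\<forall>\<^sub>F k in \<mu>. real (Suc k) > 2 * t"
          using top by (simp add: filterlim_at_top_dense)
        moreover have "\<forall>\<^sub>F k in \<mu>. 2 * a i + 1 \<le> k"
          by (rule ev[OF eventually_ge_at_top])
        moreover have "\<forall>\<^sub>F k in \<mu>. dist (y k / scale k) t < \<epsilon> / 2"
          using tendstoD[OF lim, of "\<epsilon> / 2"] \<open>\<epsilon> > 0\<close> by simp
        ultimately have "\<forall>\<^sub>F k in \<mu>. \<exists>z\<in>layer a (Suc i). dist z t < \<epsilon>"
        proof eventually_elim
          case (elim k)
          have "1 / real (Suc k) < y k / scale k" "y k / scale k < real (Suc k)"
            using elim by linarith+
          then obtain z where "z \<in> layer a (Suc i)" "\<bar>y k / scale k - z\<bar> \<le> 1 / real (Suc k)"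
            using layer_at_scale[OF y _ _ elim(5)] by blast
          moreover from this have "dist z t < \<epsilon>"
            using elim(3,6) unfolding dist_real_def min_less_iff_conj by linarith
          ultimately show ?case by blast
        qed
        thus ?thesis using nb by simp
      qed
      thus ?thesis using closed_layer closed_approachable by blast
    qed
  qed
  show "t \<in> ?T" if t: "t \<in> layer a (Suc i)" for t
  proof (cases "t = 0")
    case True
    have "\<forall>k. (0::real) \<in> layer a i" by (simp add: layer_def level.zero)
    thus ?thesis using True by (intro CollectI exI[of _ "\<lambda>_. 0"]) simp
  next
    case False
    hence tp: "t > 0" using t layer_nonneg by force
    define q where "q k = (of_int \<lfloor>real (Suc k) * t\<rfloor> :: real)" for k
    \<comment> \<open>The default 0 keeps \<open>y k\<close> in the layer while \<open>t\<close> is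
      outside the range of \<open>copy\<close>; this ends for large \<open>k\<close>.\<close>
    define y where "y k = (if 1 \<le> real (Suc k) * t \<and> t \<le> real (Suc k) then mesh k * q k else 0)" for k
    have "y k \<in> layer a i" for k
      using t unfolding y_def layer_def q_def by (auto intro: level.zero level.copy simp del: of_nat_Suc)
    moreover have "((\<lambda>k. y k / scale k) \<longlongrightarrow> t) \<mu>"
    proof (rule Lim_transform_eventually)
      have "((\<lambda>k. q k / real (Suc k) - t) \<longlongrightarrow> 0) \<mu>"
      proof (rule Lim_null_comparison[OF _ inv])
        have "norm (q k / real (Suc k) - t) \<le> 1 / real (Suc k)" for k
        proof -
          have "q k / real (Suc k) - t = (q k - real (Suc k) * t) / real (Suc k)"
            by (simp add: field_simps)
          moreover have "\<bar>q k - real (Suc k) * t\<bar> \<le> 1" unfolding q_def by linarith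
          ultimately show ?thesis by (simp add: abs_divide divide_right_mono del: of_nat_Suc)
        qed
        thus "\<forall>\<^sub>F k in \<mu>. norm (q k / real (Suc k) - t) \<le> 1 / real (Suc k)" by simp
      qed
      thus "((\<lambda>k. q k / real (Suc k)) \<longlongrightarrow> t) \<mu>" by (rule Lim_null[THEN iffD2])
      have "\<forall>\<^sub>F k in \<mu>. real (Suc k) > 1 / t" "\<forall>\<^sub>F k in \<mu>. real (Suc k) > t"
        using top by (simp_all add: filterlim_at_top_dense)
      thus "\<forall>\<^sub>F k in \<mu>. q k / real (Suc k) = y k / scale k"
      proof eventually_elim
        case (elim k)
        have "y k = mesh k * q k"
          using elim tp by (simp add: y_def field_simps)
        thus ?case using mesh_ge_1[of k] by (simp add: scale_def)
      qed
    qed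
    ultimately show ?thesis by blast
  qed
qed

section \<open>The topology of the layers\<close>

text \<open>The parity of \<open>k\<close> is what matters: unit gaps that begin at an odd integer
  are empty, which isolates the intervals.\<close>

lemma between_Nats_in_blocks:
  assumes z: "z \<in> \<nat> \<union> blocks n" "real k < z" "z < real k + 1"
  obtains m where "m < n" "k = 2 * m + 2"
proof -
  have "z \<notin> \<nat>"
  proof
    assume "z \<in> \<nat>" then obtain l where "z = real l" by (auto simp: Nats_def)
    thus False using z(2,3) by simp
  qed
  then obtain m where m: "m < n" "2 * real m + 2 \<le> z" "z \<le> 2 * real m + 3"
    using z(1) by (auto simp: blocks_def)
  hence "real k < real (2 * m + 3)" "real (2 * m + 2) < real (k + 1)" using z by simp_all
  hence "k = 2 * m + 2" unfolding of_nat_less_iff by linarith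
  thus ?thesis using m(1) that by blast
qed

text \<open>A connected set with two points contains a non-integer, hence a point inside some
  interval. To leave this interval it would have to enter a neighbouring gap, which begins at an odd
  integer and is empty.\<close>

lemma connected_subset_blocks:
  assumes C: "connected C" "C \<subseteq> \<nat> \<union> blocks n" and xy: "x \<in> C" "y \<in> C" "x < y"
  obtains m where "m < n" "C \<subseteq> {2 * real m + 2..2 * real m + 3}"
proof -
  have conv: "z \<in> C" if "x' \<in> C" "y' \<in> C" "x' \<le> z" "z \<le> y'" for x' y' z
    by (rule connectedD_interval[OF C(1) that])
  have "x \<ge> 0" using xy(1) C(2) blocks_bounds[of n] by (force simp: Nats_def)
  define k where "k = nat \<lfloor>x\<rfloor>"
  have k: "real k \<le> x" "x < real k + 1" using \<open>x \<ge> 0\<close> unfolding k_def by linarith+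
  \<comment> \<open>The midpoint of \<open>x\<close> and the nearer of \<open>y\<close> and
    \<open>k + 1\<close> lies strictly inside the unit gap.\<close>
  define z where "z = (x + min y (real k + 1)) / 2"
  have z: "real k < z" "z < real k + 1" "x \<le> z" "z \<le> y"
    using k xy(3) by (auto simp: z_def min_def)
  have zC: "z \<in> C" using conv[OF xy(1,2)] z by simp
  then obtain m where m: "m < n" "k = 2 * m + 2"
    using between_Nats_in_blocks[OF _ z(1,2)] C(2) by blast
  have "w \<in> {2 * real m + 2..2 * real m + 3}" if w: "w \<in> C" for w
  proof (rule ccontr)
    assume "w \<notin> {2 * real m + 2..2 * real m + 3}"
    then consider "w < real (2 * m + 1) + 1" | "real (2 * m + 3) < w" by force
    thus False
    proof cases
      case 1
      \<comment> \<open>A point between \<open>w\<close> and \<open>z\<close> in the gap just left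
        of the interval; the other case is symmetric.\<close>
      define v where "v = (max w (real (2 * m + 1)) + (real (2 * m + 1) + 1)) / 2"
      have v: "real (2 * m + 1) < v" "v < real (2 * m + 1) + 1" "w \<le> v"
        using 1 by (auto simp: v_def max_def)
      have "v \<in> C" using conv[OF w zC] v z(1) m(2) by simp
      with between_Nats_in_blocks[OF _ v(1,2)] C(2) obtain m' where "2 * m + 1 = 2 * m' + 2" by blast
      thus False by presburger
    next
      case 2
      define v where "v = (real (2 * m + 3) + min w (real (2 * m + 3) + 1)) / 2"
      have v: "real (2 * m + 3) < v" "v < real (2 * m + 3) + 1" "v \<le> w"
        using 2 by (auto simp: v_def min_def)
      have "v \<in> C" using conv[OF zC w] v z(2) m(2) by simp
      with between_Nats_in_blocks[OF _ v(1,2)] C(2) obtain m' where "2 * m + 3 = 2 * m' + 2" by blast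
      thus False by presburger
    qed
  qed
  thus ?thesis using that m(1) by blast
qed

text \<open>
  A homeomorphism carries each of the intervals into one of the intervals, and distinct ones into
  distinct ones.
\<close>

lemma blocks_count_le:
  assumes A: "blocks n \<subseteq> A" "A \<subseteq> \<nat> \<union> blocks n" and B: "blocks n' \<subseteq> B" "B \<subseteq> \<nat> \<union> blocks n'"
    and hom: "A homeomorphic B"
  shows "n \<le> n'"
proof -
  obtain f g where fg: "homeomorphism A B f g" using hom by (auto simp: homeomorphic_def)
  let ?I = "\<lambda>m. {2 * real m + 2..2 * real m + 3}"
  have I: "?I m \<subseteq> blocks k" if "m < k" for m k using that by (auto simp: blocks_def)
  have "\<exists>m'<n'. f ` ?I m \<subseteq> ?I m'" if m: "m < n" for m
  proof -
    have IA: "?I m \<subseteq> A" using I[OF m] A(1) by blast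
    have con: "connected (f ` ?I m)"
      by (intro connected_continuous_image continuous_on_subset[OF homeomorphism_cont1[OF fg] IA]) auto
    have sub: "f ` ?I m \<subseteq> \<nat> \<union> blocks n'"
      using homeomorphism_image1[OF fg] IA B(2) by blast
    let ?p = "f (2 * real m + 2)" and ?q = "f (2 * real m + 3)"
    have "2 * real m + 2 \<in> A" "2 * real m + 3 \<in> A" using IA by auto
    \<comment> \<open>Injectivity keeps the image from collapsing to a point, so it must lie in a
      single interval.\<close>
    hence "?p \<noteq> ?q" using homeomorphism_apply1[OF fg, of "2 * real m + 2"]
        homeomorphism_apply1[OF fg, of "2 * real m + 3"]
      by auto
    moreover have "?p \<in> f ` ?I m" "?q \<in> f ` ?I m" by auto
    ultimately show ?thesis
      using connected_subset_blocks[OF con sub] by (metis linorder_neqE)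
  qed
  then obtain s where s: "\<And>m. m < n \<Longrightarrow> s m < n'" "\<And>m. m < n \<Longrightarrow> f ` ?I m \<subseteq> ?I (s m)"
    by metis
  have "inj_on s {..<n}"
  proof (rule inj_onI)
    fix m1 m2 assume m: "m1 \<in> {..<n}" "m2 \<in> {..<n}" and eq: "s m1 = s m2"
    let ?x = "2 * real m1 + 2" and ?y = "2 * real m2 + 2"
    have xyA: "?x \<in> A" "?y \<in> A" using I m A(1) by force+
    \<comment> \<open>If two intervals land in the same one, its image under \<open>g\<close> is
      connected and contains both left endpoints, hence lies in one interval.\<close>
    have sub: "?I (s m1) \<subseteq> B" using I s(1) m(1) B(1) by blast
    have con: "connected (g ` ?I (s m1))"
      by (intro connected_continuous_image continuous_on_subset[OF homeomorphism_cont2[OF fg] sub]) auto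
    have gsub: "g ` ?I (s m1) \<subseteq> \<nat> \<union> blocks n"
      using homeomorphism_image2[OF fg] sub A(2) by blast
    have fx: "f ?x \<in> ?I (s m1)" by (rule subsetD[OF s(2) imageI]) (use m in auto)
    have fy: "f ?y \<in> ?I (s m1)" unfolding eq by (rule subsetD[OF s(2) imageI]) (use m in auto)
    have xy: "?x \<in> g ` ?I (s m1)" "?y \<in> g ` ?I (s m1)"
      using fx[THEN imageI, of g] fy[THEN imageI, of g] 
      by (simp_all only: homeomorphism_apply1[OF fg xyA(1)] homeomorphism_apply1[OF fg xyA(2)])
    show "m1 = m2"
    proof (rule ccontr)
      assume "m1 \<noteq> m2"
      hence "?x < ?y \<or> ?y < ?x" by linarith
      then obtain m' where "g ` ?I (s m1) \<subseteq> ?I m'"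
        using connected_subset_blocks[OF con gsub] xy by metis
      hence "?x \<in> ?I m'" "?y \<in> ?I m'" using xy by blast+
      hence "\<bar>real m1 - real m2\<bar> < 1" by simp
      thus False using \<open>m1 \<noteq> m2\<close> by linarith
    qed
  qed
  moreover have "s ` {..<n} \<subseteq> {..<n'}" using s(1) by auto
  ultimately have "card {..<n} \<le> card {..<n'}" by (intro card_inj_on_le) auto
  thus ?thesis by simp
qed

text \<open>The points \<open>scale k\<close> tend to infinity, so they leave the bounded blocks and
  every finite set.\<close>

lemma infinite_layer_minus_blocks: "infinite (layer a i - blocks n)"
proof
  assume fin: "finite (layer a i - blocks n)"
  have "eventually (\<lambda>k. scale k > 2 * real n + 1) sequentially"
    using scaling_factor_scale by (simp add: scaling_factor_def filterlim_at_top_dense)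
  \<comment> \<open>Inserting 0 keeps the argument of \<open>Max\<close> nonempty.\<close>
  moreover have "eventually (\<lambda>k. scale k > Max (insert 0 (layer a i - blocks n))) sequentially"
    using scaling_factor_scale by (simp add: scaling_factor_def filterlim_at_top_dense)
  ultimately have "eventually (\<lambda>k. False) sequentially"
  proof eventually_elim
    case (elim k)
    have "scale k \<notin> blocks n" using blocks_bounds[of n] elim(1) by force
    hence "scale k \<in> layer a i - blocks n" using scale_in_layer by blast
    thus False using elim(2) fin by (meson Max_ge finite_insert insertI2 not_le)
  qed
  thus False by simp
qed

text \<open>The identity on the blocks is glued to an arbitrary bijection of the remaining points,
  which are countably infinite and discrete on both sides.\<close>

lemma homeomorphic_blocks_union:
  assumes A: "blocks n \<subseteq> A" "A \<subseteq> \<nat> \<union> blocks n" "infinite (A - blocks n)"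
    and B: "blocks n \<subseteq> B" "B \<subseteq> \<nat> \<union> blocks n" "infinite (B - blocks n)"
  shows "A homeomorphic B"
proof -
  have count: "countable (S - blocks n)" if "S \<subseteq> \<nat> \<union> blocks n" for S
    by (rule countable_subset[of _ "\<nat>"]) (use that in \<open>auto simp: Nats_def\<close>)
  obtain h where h: "bij_betw h (A - blocks n) (B - blocks n)"
    using count[OF A(2)] count[OF B(2)] A(3) B(3)
    by (meson bij_betw_trans bij_betw_from_nat_into to_nat_on_infinite)
  let ?k = "inv_into (A - blocks n) h"
  define ext :: "(real \<Rightarrow> real) \<Rightarrow> real \<Rightarrow> real" where "ext \<phi> x = (if x \<in> blocks n then x else \<phi> x)" for \<phi> x
  \<comment> \<open>Any \<phi> will do: every set of remaining points consists of integers and is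
    closed, so all preimages are closed. The two closed parts are disjoint, hence the gluing is
    continuous.\<close>
  have cont: "continuous_on S (ext \<phi>)" if S: "blocks n \<subseteq> S" "S \<subseteq> \<nat> \<union> blocks n" for S \<phi>
  proof -
    have "continuous_on (blocks n \<union> (S - blocks n)) (ext \<phi>)"
      unfolding ext_def
    proof (rule continuous_on_cases)
      have closed: "closed T" if "T \<subseteq> S - blocks n" for T
        by (rule closed_subset_Ints) (use S that Nats_subset_Ints in blast)
      show "closed (S - blocks n)" by (rule closed) simp
      thus "continuous_on (S - blocks n) \<phi>"
        unfolding continuous_on_closed_vimage[OF \<open>closed (S - blocks n)\<close>] by (simp add: closed)
    qed (use closed_blocks in auto)
    thus ?thesis using S(1) by (simp add: Un_absorb1)
  qed
  have hB: "h x \<in> B - blocks n" if "x \<in> A - blocks n" for x using h that by (rule bij_betwE[rule_format])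
  have kA: "?k y \<in> A - blocks n" if "y \<in> B - blocks n" for y
    using bij_betw_inv_into[OF h] that by (rule bij_betwE[rule_format])
  have "homeomorphism A B (ext h) (ext ?k)"
  proof (rule homeomorphismI)
    show "continuous_on A (ext h)" "continuous_on B (ext ?k)" using cont A B by blast+
    show "ext h ` A \<subseteq> B" "ext ?k ` B \<subseteq> A"
      using hB kA A(1) B(1) by (auto simp: ext_def)
    show "ext ?k (ext h x) = x" if "x \<in> A" for x
      using that hB[of x] bij_betw_inv_into_left[OF h, of x] by (auto simp: ext_def)
    show "ext h (ext ?k y) = y" if "y \<in> B" for y
      using that kA[of y] bij_betw_inv_into_right[OF h, of y] by (auto simp: ext_def)
  qed
  thus ?thesis by (auto simp: homeomorphic_def)
qed

section \<open>Passage to abstract topology and conclusion\<close>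

lemma homeomorphic_maps_top_of_set:
  "homeomorphic_maps (top_of_set S) (top_of_set T) f g \<longleftrightarrow> homeomorphism S T f g"
proof
  assume "homeomorphic_maps (top_of_set S) (top_of_set T) f g"
  thus "homeomorphism S T f g"
    by (intro homeomorphismI) (auto simp: homeomorphic_maps_def continuous_map_in_subtopology)
next
  assume fg: "homeomorphism S T f g"
  thus "homeomorphic_maps (top_of_set S) (top_of_set T) f g"
    using homeomorphism_image1[OF fg] homeomorphism_image2[OF fg] homeomorphism_cont1[OF fg]
      homeomorphism_cont2[OF fg] homeomorphism_apply1[OF fg] homeomorphism_apply2[OF fg]
    by (simp add: homeomorphic_maps_def continuous_map_in_subtopology image_subset_iff_funcset[symmetric])
qed

lemma homeomorphic_space_top_of_set:
  "top_of_set S homeomorphic_space top_of_set T \<longleftrightarrow> S homeomorphic T"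
  by (simp add: homeomorphic_space_def homeomorphic_def homeomorphic_maps_top_of_set)

lemma layer_homeomorphic_iff: "layer a i homeomorphic layer a j \<longleftrightarrow> a i = a j"
proof
  assume hom: "layer a i homeomorphic layer a j"
  note le = blocks_count_le[OF blocks_subset_layer layer_subset blocks_subset_layer layer_subset]
  show "a i = a j"
    using le[OF hom] le[OF homeomorphic_sym[THEN iffD1, OF hom]] by (rule antisym)
next
  assume "a i = a j"
  thus "layer a i homeomorphic layer a j"
    using blocks_subset_layer[of a i] blocks_subset_layer[of a j] layer_subset[of a i] layer_subset[of a j]
    by (intro homeomorphic_blocks_union[of "a i"] infinite_layer_minus_blocks) simp_all
qed

theorem theorem4p8:
  fixes a :: "nat \<Rightarrow> nat"
  shows "\<exists>(X :: real metric) (e :: real) (\<alpha> :: nat \<Rightarrow> nat \<Rightarrow> real).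
    e \<in> mspace X \<and> (\<forall>n. scaling_factor (\<alpha> n)) \<and>
    (\<forall>\<mu>. nonprincipal_ultrafilter \<mu> \<longrightarrow>
      (\<forall>i j. mtopology_of (iter_cone \<mu> X e \<alpha> i) homeomorphic_space
              mtopology_of (iter_cone \<mu> X e \<alpha> j) \<longleftrightarrow> a i = a j))"
proof -
  \<comment> \<open>The space and the scaling factors are fixed before \<mu>, as the order of
    quantifiers demands.\<close>
  define X where "X = submetric euclidean_metric (layer a 0)"
  have 0: "0 \<in> mspace X" by (simp add: X_def layer_def level.zero)
  have iso0: "pointed_isometric X 0 (layer a 0)"
    using 0 unfolding pointed_isometric_def
    by (auto simp: X_def dist_real_def intro!: exI[of _ id])
  have "mtopology_of (iter_cone \<mu> X 0 (\<lambda>_. scale) i) homeomorphic_space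
      mtopology_of (iter_cone \<mu> X 0 (\<lambda>_. scale) j) \<longleftrightarrow> a i = a j"
    if \<mu>: "nonprincipal_ultrafilter \<mu>" for \<mu> i j
  proof -
    have u: "ultrafilter \<mu>" and nb: "\<mu> \<noteq> bot"
      using \<mu> by (auto simp: nonprincipal_ultrafilter_def ultrafilter_def)
    have "pointed_isometric (iter_cone \<mu> X 0 (\<lambda>_. scale) k) (iter_base \<mu> X 0 (\<lambda>_. scale) k) (layer a k)" for k
      using layer_rescaled_limits[OF nb nonprincipal_ultrafilter_le_sequentially[OF \<mu>]]
      by (intro iter_cone_pointed_isometric[OF u, of "\<lambda>_. scale" X 0 "layer a"])
        (use scaling_factor_scale iso0 layer_nonneg in auto)
    hence "mtopology_of (iter_cone \<mu> X 0 (\<lambda>_. scale) k) homeomorphic_space top_of_set (layer a k)" for k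
      by (rule pointed_isometric_homeomorphic)
    hence "mtopology_of (iter_cone \<mu> X 0 (\<lambda>_. scale) i) homeomorphic_space
      mtopology_of (iter_cone \<mu> X 0 (\<lambda>_. scale) j) \<longleftrightarrow>
      top_of_set (layer a i) homeomorphic_space top_of_set (layer a j)"
      by (meson homeomorphic_space_sym homeomorphic_space_trans)
    thus ?thesis using layer_homeomorphic_iff by (simp add: homeomorphic_space_top_of_set)
  qed
  thus ?thesis using 0 scaling_factor_scale
    by (intro exI[of _ X] exI[of _ 0] exI[of _ "\<lambda>_. scale"]) blast
qed

end
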